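(* Every circular composition appears exactly once as a vertex label in the tree of circular compositions, and every vertex label of this tree is a circular composition.
   Context: A composition of $n$ is a finite sequence $(\lambda_1,\dots,\lambda_r)$ of positive integers with sum $n$. For $\llbracket a,b\rrbracket=[a,b]\cap\mathbb{Z}$, define $B_i=\llbracket 1+\sum_{j<i}\lambda_j,\ \sum_{j\le i}\lambda_j\rrbracket$ and $s_i=\sum_{j>i}\lambda_j-\sum_{j<i}\lambda_j$. The symmetric discrete interval exchange $T_\lambda$ is the permutation of $\llbracket 1,n\rrbracket$ given by $T_\lambda(x)=x+s_i$ for $x\in B_i$. A composition $\lambda$ is circular if $T_\lambda$ has exactly one orbit. For a composition $\lambda=(\lambda_1,\dots,\lambda_r)$ of $n$ and $t\in\{0,\dots,r\}$ put $\delta_t=n-2\sum_{j\le t}\lambda_j$, with the convention $\lambda_0=\lambda_{r+1}=0$. The children of $\lambda$ are: (Type 1) $(\lambda_1,\dots,\lambda_{t-1},\lambda_t+|s_t|,\lambda_{t+1},\dots,\lambda_r)$ for each $t\in\{1,\dots,r\}$; (Type 2) $(\lambda_1,\dots,\lambda_t,|\delta_t|,\lambda_{t+1},\dots,\lambda_r)$ for each $t\in\{0,\dots,r\}$ such that $\delta_t>\lambda_{t+1}$ or $-\delta_t>\lambda_t$. The tree of circular compositions is the infinite rooted tree with root labelled $(1,1)$ in which the children of each vertex labelled $\lambda$ are vertices labelled by the children of $\lambda$.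
   Formalization: The one-part composition (1) is excluded from the first claim: it is circular by the definition (one point, one orbit), but it cannot appear in the tree, whose root is (1,1) and whose labels never decrease in sum. *)

theory Defs
  imports "HOL-Combinatorics.Orbits"
begin

definition composition_of :: "nat \<Rightarrow> nat list \<Rightarrow> bool" where
  "composition_of n l \<longleftrightarrow> (\<forall>a\<in>set l. 0 < a) \<and> sum_list l = n"

text \<open>Parts are numbered from 1. Outside the index range the value is 0, which covers
  the convention \<open>\<lambda>\<^sub>0 = \<lambda>\<^bsub>r+1\<^esub> = 0\<close>.\<close>

definition part :: "nat list \<Rightarrow> nat \<Rightarrow> int" where
  "part l i = (if 1 \<le> i \<and> i \<le> length l then int (l ! (i - 1)) else 0)"

definition block :: "nat list \<Rightarrow> nat \<Rightarrow> int set" where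
  "block l i = {1 + (\<Sum>j\<in>{1..<i}. part l j) .. (\<Sum>j\<in>{1..i}. part l j)}"

definition shift :: "nat list \<Rightarrow> nat \<Rightarrow> int" where
  "shift l i = (\<Sum>j\<in>{i<..length l}. part l j) - (\<Sum>j\<in>{1..<i}. part l j)"

text \<open>The blocks partition \<open>{1..n}\<close>; as usual for permutations of a subset of a type, the map is
  extended by the identity.\<close>

definition interval_exchange :: "nat list \<Rightarrow> int \<Rightarrow> int" where
  "interval_exchange l x =
    (if \<exists>i\<in>{1..length l}. x \<in> block l i
     then x + shift l (THE i. i \<in> {1..length l} \<and> x \<in> block l i)
     else x)"

definition circular :: "nat list \<Rightarrow> bool" where
  "circular l \<longleftrightarrow> (\<exists>n. composition_of n l \<and>
     card (orbit (interval_exchange l) ` {1..int n}) = 1)"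

definition delta :: "nat list \<Rightarrow> nat \<Rightarrow> int" where
  "delta l t = int (sum_list l) - 2 * (\<Sum>j\<in>{1..t}. part l j)"

datatype child_index = Type1 nat | Type2 nat

fun has_child :: "nat list \<Rightarrow> child_index \<Rightarrow> bool" where
  "has_child l (Type1 t) \<longleftrightarrow> t \<in> {1..length l}"
| "has_child l (Type2 t) \<longleftrightarrow>
     t \<in> {0..length l} \<and> (delta l t > part l (t + 1) \<or> - delta l t > part l t)"

fun child :: "nat list \<Rightarrow> child_index \<Rightarrow> nat list" where
  "child l (Type1 t) = l[t - 1 := l ! (t - 1) + nat \<bar>shift l t\<bar>]"
| "child l (Type2 t) = take t l @ [nat \<bar>delta l t\<bar>] @ drop t l"

text \<open>A vertex of the tree is represented by its address, the list of child indices on the path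
  from the root. Hence distinct vertices might a priori carry the same label, including
  siblings of different index.\<close>

definition label :: "child_index list \<Rightarrow> nat list" where
  "label v = foldl child [1, 1] v"

inductive_set tree_vertices :: "child_index list set" where
  root: "[] \<in> tree_vertices"
| child: "v \<in> tree_vertices \<Longrightarrow> has_child (label v) c \<Longrightarrow> v @ [c] \<in> tree_vertices"

end

theory Submission
  imports Defs
begin

text \<open>
  Write a composition as \<open>A @ k # B\<close> and let \<open>s = \<Sum>B - \<Sum>A\<close> be the shift of the
  distinguished block; \<open>k = 0\<close> stands for an absent part. Enlarging \<open>k\<close> by \<open>\<bar>s\<bar>\<close> does not
  change \<open>s\<close>, and the old exchange is the first return map of the new one to the complement
  of the last (if \<open>s > 0\<close>) or first (if \<open>s < 0\<close>) \<open>\<bar>s\<bar>\<close> points of the enlarged block, since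
  each of these points leaves that set in one step. So circularity is the same before and after.
  Both types of children are instances: type 1 has \<open>k > 0\<close>, type 2 has \<open>k = 0\<close>.

  Conversely, a part \<open>k\<close> can have been enlarged only if \<open>k \<ge> \<bar>s\<bar>\<close>, which says that its block
  touches the midpoint of \<open>{1..n}\<close>. This determines the block unless the midpoint separates
  two blocks. In that case the condition in type 2 selects the longer of the two; if they are
  equally long, the exchange swaps them, and circularity forces the composition \<open>(1,1)\<close>.
\<close>

section \<open>The exchange as a recursive function\<close>

abbreviation weight :: "nat list \<Rightarrow> int" where
  "weight l \<equiv> int (sum_list l)"

text \<open>Prefixing a part \<open>k\<close> lowers the shift of every later block by
  \<open>k\<close>, so a point beyond the first block moves as \<open>x - int k\<close> does under
  \<open>B\<close>. There is no range check: agreement with \<open>interval_exchange\<close> is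
  claimed only on \<open>{1..weight l}\<close>.\<close>

fun exchange :: "nat list \<Rightarrow> int \<Rightarrow> int" where
  "exchange [] x = x"
| "exchange (k # B) x = (if x \<le> int k then x + weight B else exchange B (x - int k))"

section \<open>Index sums as weights of prefixes\<close>

lemma sum_part_eq_weight_take: "(\<Sum>j\<in>{1..t}. part l j) = weight (take t l)"
proof (induction t)
  case (Suc t)
  then show ?case
    by (cases "t < length l") (auto simp: part_def take_Suc_conv_app_nth)
qed simp

lemma sum_part_less_eq_weight_take: "(\<Sum>j\<in>{1..<i}. part l j) = weight (take (i - 1) l)"
proof (cases i)
  case (Suc j)
  then show ?thesis
    using sum_part_eq_weight_take[of l j] by (simp add: atLeastLessThanSuc_atLeastAtMost)
qed simp

lemma block_eq: "block l i = {1 + weight (take (i - 1) l) .. weight (take i l)}"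
  unfolding block_def sum_part_eq_weight_take sum_part_less_eq_weight_take ..

lemma shift_eq:
  assumes "i \<le> length l"
  shows "shift l i = weight (drop i l) - weight (take (i - 1) l)"
proof -
  have "(\<Sum>j\<in>{1..length l}. part l j) = (\<Sum>j\<in>{1..i}. part l j) + (\<Sum>j\<in>{i<..length l}. part l j)"
    using assms by (subst sum.union_disjoint[symmetric]) (auto intro!: sum.cong)
  then have "weight l = weight (take i l) + (\<Sum>j\<in>{i<..length l}. part l j)"
    by (simp add: sum_part_eq_weight_take del: One_nat_def)
  moreover have "weight l = weight (take i l) + weight (drop i l)"
    by (metis append_take_drop_id of_nat_add sum_list_append)
  ultimately show ?thesis
    unfolding shift_def sum_part_less_eq_weight_take by simp
qed

lemma delta_append: "delta (A @ B) (length A) = weight B - weight A"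
  unfolding delta_def sum_part_eq_weight_take by simp

lemma weight_take_mono: "i \<le> j \<Longrightarrow> weight (take i l) \<le> weight (take j l)"
  by (metis le_add1 le_add_diff_inverse of_nat_le_iff sum_list_append take_add)

lemma block_unique:
  assumes "x \<in> block l i" "x \<in> block l j"
  shows "i = j"
proof -
  have "\<not> i < j" if "x \<in> block l i" "x \<in> block l j" for i j
  proof
    assume "i < j"
    then have "weight (take i l) \<le> weight (take (j - 1) l)"
      by (intro weight_take_mono) simp
    then show False
      using that by (simp add: block_eq)
  qed
  then show ?thesis
    using assms by (meson nat_neq_iff)
qed

lemma interval_exchange_append:
  assumes "weight A < x" "x \<le> weight A + int k"
  shows "interval_exchange (A @ k # B) x = x + weight B - weight A"
proof -
  let ?l = "A @ k # B" and ?i = "Suc (length A)"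
  have mem: "x \<in> block ?l ?i"
    using assms by (simp add: block_eq)
  have "(THE i. i \<in> {1..length ?l} \<and> x \<in> block ?l i) = ?i"
  proof (rule the_equality)
    show "?i \<in> {1..length ?l} \<and> x \<in> block ?l ?i"
      using mem by simp
    show "i = ?i" if "i \<in> {1..length ?l} \<and> x \<in> block ?l i" for i
      using block_unique[OF _ mem] that by blast
  qed
  moreover have "\<exists>i\<in>{1..length ?l}. x \<in> block ?l i"
    using mem by (intro bexI[of _ ?i]) auto
  ultimately show ?thesis
    unfolding interval_exchange_def by (simp add: shift_eq)
qed

text \<open>Serves twice: to read off the shift of an arbitrary point, and later to find the block
  at the midpoint.\<close>

lemma ex_block_decomposition:
  assumes "0 < x" "x \<le> weight l"
  obtains A k B where "l = A @ k # B" "weight A < x" "x \<le> weight A + int k"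
  using assms
proof (induction l arbitrary: x thesis)
  case (Cons k l)
  show ?case
  proof (cases "x \<le> int k")
    case True
    then show ?thesis
      using Cons.prems(1)[of "[]" k l] Cons.prems(2) by simp
  next
    case False
    then obtain A m B where "l = A @ m # B" "weight A < x - int k" "x - int k \<le> weight A + int m"
      using Cons.IH[of "x - int k"] Cons.prems(3) by auto
    then show ?thesis
      using Cons.prems(1)[of "k # A" m B] by simp
  qed
qed simp

lemma exchange_append_left:
  "0 < x \<Longrightarrow> x \<le> weight A \<Longrightarrow> exchange (A @ B) x = exchange A x + weight B"
  by (induction A arbitrary: x) auto

lemma exchange_append_right:
  "0 < x \<Longrightarrow> exchange (A @ B) (x + weight A) = exchange B x"
proof (induction A arbitrary: x)
  case (Cons k A)
  then show ?case
    using Cons.IH[of x] by (simp add: algebra_simps)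
qed simp

lemma interval_exchange_eq_exchange:
  assumes "0 < x" "x \<le> weight l"
  shows "interval_exchange l x = exchange l x"
proof -
  obtain A k B where l: "l = A @ k # B" "weight A < x" "x \<le> weight A + int k"
    using ex_block_decomposition assms .
  then show ?thesis
    using interval_exchange_append[of A x k B] exchange_append_right[of "x - weight A" A "k # B"]
    by simp
qed

text \<open>The first block is translated onto the last \<open>k\<close> places; the remaining
  points fill the first \<open>weight B\<close> places by induction.\<close>

lemma exchange_image: "exchange l ` {1..weight l} = {1..weight l}"
proof (induction l)
  case (Cons k B)
  have "{1..weight (k # B)} = {1..int k} \<union> (\<lambda>x. x + int k) ` {1..weight B}"
    by (auto simp: image_iff)
  then have "exchange (k # B) ` {1..weight (k # B)} =
      exchange (k # B) ` {1..int k} \<union> (\<lambda>x. exchange (k # B) (x + int k)) ` {1..weight B}"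
    by (simp only: image_Un image_image)
  also have "exchange (k # B) ` {1..int k} = (\<lambda>x. x + weight B) ` {1..int k}"
    by (intro image_cong) auto
  also have "(\<lambda>x. exchange (k # B) (x + int k)) ` {1..weight B} = exchange B ` {1..weight B}"
    by (intro image_cong) auto
  also have "\<dots> = {1..weight B}"
    by (rule Cons.IH)
  also have "(\<lambda>x. x + weight B) ` {1..int k} \<union> {1..weight B} = {1..weight (k # B)}"
    by (auto simp: image_iff)
  finally show ?case .
qed simp

section \<open>Transitivity and first return maps\<close>

text \<open>\<open>orbit f x\<close> collects the iterates with at least one application of
  \<open>f\<close>, so the case \<open>y = x\<close> demands that \<open>x\<close> be
  periodic.\<close>

definition transitive_on :: "('a \<Rightarrow> 'a) \<Rightarrow> 'a set \<Rightarrow> bool" where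
  "transitive_on f X \<longleftrightarrow> (\<forall>x\<in>X. \<forall>y\<in>X. y \<in> orbit f x)"

lemma orbit_cong_invariant:
  assumes "x \<in> X" "f ` X \<subseteq> X" "\<And>z. z \<in> X \<Longrightarrow> f z = g z"
  shows "orbit f x = orbit g x"
proof -
  have inv: "f z \<in> X" if "z \<in> X" for z
    using that assms(2) by blast
  have "z \<in> orbit g x \<and> z \<in> X" if "z \<in> orbit f x" for z
    using that
  proof induction
    case base
    show ?case
      using inv[OF assms(1)] assms(3)[OF assms(1)] orbit.base[of g x] by simp
  next
    case (step z)
    then show ?case
      using inv[of z] assms(3)[of z] orbit.step[of z g x] by simp
  qed
  moreover have "z \<in> orbit f x \<and> z \<in> X" if "z \<in> orbit g x" for z
    using that
  proof induction
    case base
    show ?case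
      using inv[OF assms(1)] assms(3)[OF assms(1)] orbit.base[of f x] by simp
  next
    case (step z)
    then show ?case
      using inv[of z] assms(3)[of z] orbit.step[of z f x] by simp
  qed
  ultimately show ?thesis
    by blast
qed

lemma transitive_on_iff_card_orbits:
  assumes "f ` X = X"
  shows "card (orbit f ` X) = 1 \<longleftrightarrow> X \<noteq> {} \<and> transitive_on f X"
proof
  assume "card (orbit f ` X) = 1"
  then obtain O' where O': "orbit f ` X = {O'}"
    by (auto simp: card_1_singleton_iff)
  have "y \<in> orbit f x" if "x \<in> X" "y \<in> X" for x y
  proof -
    \<comment> \<open>It is not yet known that \<open>y\<close> lies in its own orbit, but it lies
      in that of a preimage, and all orbits coincide.\<close>
    obtain z where "z \<in> X" "y = f z"
      using assms \<open>y \<in> X\<close> by blast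
    then have "y \<in> orbit f z"
      by (simp add: orbit.base)
    then show ?thesis
      using O' \<open>z \<in> X\<close> \<open>x \<in> X\<close> by blast
  qed
  then show "X \<noteq> {} \<and> transitive_on f X"
    using O' by (auto simp: transitive_on_def)
next
  assume *: "X \<noteq> {} \<and> transitive_on f X"
  have "orbit f x = X" if "x \<in> X" for x
  proof
    show "orbit f x \<subseteq> X"
    proof
      fix z assume "z \<in> orbit f x"
      then show "z \<in> X"
        by induction (use assms that in auto)
    qed
  qed (use * that in \<open>auto simp: transitive_on_def\<close>)
  then have "orbit f ` X = {X}"
    using * by auto
  then show "card (orbit f ` X) = 1"
    by simp
qed

text \<open>\<open>e\<close> embeds \<open>Y\<close> into \<open>X\<close>, and \<open>g\<close> is
  the return map of \<open>f\<close> to the image, with return time at most two. Since points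
  outside the image come back in one step, every orbit of \<open>f\<close> is visible in the
  image.\<close>

lemma transitive_on_first_return:
  assumes f: "f ` X = X" and g: "g ` Y \<subseteq> Y"
    and e: "inj_on e Y" "e ` Y \<subseteq> X"
    and skip: "\<And>x. x \<in> X \<Longrightarrow> x \<notin> e ` Y \<Longrightarrow> f x \<in> e ` Y"
    and return: "\<And>y. y \<in> Y \<Longrightarrow>
      f (e y) = e (g y) \<or> f (e y) \<notin> e ` Y \<and> f (f (e y)) = e (g y)"
  shows "transitive_on f X \<longleftrightarrow> transitive_on g Y"
proof
  assume tr: "transitive_on f X"
  show "transitive_on g Y"
    unfolding transitive_on_def
  proof (intro ballI)
    fix y y' assume y: "y \<in> Y" "y' \<in> Y"
    have orb: "w \<in> Y" if "w \<in> orbit g y" for w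
      using that by induction (use g y in auto)
    \<comment> \<open>Invariant along the orbit of \<open>f\<close>: a point is either the image of
      a point of the orbit of \<open>g\<close>, or an excursion that falls back there at the next
      step.\<close>
    have "z \<in> e ` orbit g y \<or> z \<notin> e ` Y \<and> f z \<in> e ` orbit g y"
      if "z \<in> orbit f (e y)" for z
      using that
    proof induction
      case base
      show ?case
        using return[OF y(1)] by (auto intro: orbit.base)
    next
      case (step z)
      show ?case
      proof (cases "z \<in> e ` orbit g y")
        case True
        then obtain w where w: "w \<in> orbit g y" "z = e w"
          by blast
        then have "g w \<in> orbit g y"
          by (simp add: orbit.step)
        then show ?thesis
          using return[OF orb[OF w(1)]] w by auto
      next
        case False
        then show ?thesis
          using step.IH by blast
      qed
    qed
    moreover have "e y' \<in> orbit f (e y)"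
      using tr y e(2) unfolding transitive_on_def by blast
    ultimately have "e y' \<in> e ` orbit g y"
      using y by blast
    then show "y' \<in> orbit g y"
      using orb y e(1) by (auto simp: inj_on_def)
  qed
next
  assume tr: "transitive_on g Y"
  have lift: "e w \<in> orbit f (e y)" if "w \<in> orbit g y" "y \<in> Y" for w y
  proof -
    have "w \<in> Y \<and> e w \<in> orbit f (e y)"
      using that(1)
    proof induction
      case base
      have "f (e y) \<in> orbit f (e y)" "f (f (e y)) \<in> orbit f (e y)"
        by (auto intro: orbit.intros)
      then show ?case
        using return[OF that(2)] that(2) g by auto
    next
      case (step w)
      then have "f (e w) \<in> orbit f (e y)" "f (f (e w)) \<in> orbit f (e y)"
        by (auto intro: orbit.intros)
      then show ?case
        using return[of w] step.IH g by auto
    qed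
    then show ?thesis ..
  qed
  have to_image: "e w \<in> orbit f x" if "x \<in> X" "w \<in> Y" for x w
  proof (cases "x \<in> e ` Y")
    case True
    then show ?thesis
      using lift tr that by (auto simp: transitive_on_def)
  next
    case False
    then obtain y where y: "y \<in> Y" "f x = e y"
      using skip \<open>x \<in> X\<close> by blast
    then have "e w \<in> orbit f (f x)"
      using lift tr that by (auto simp: transitive_on_def)
    then show ?thesis
      by (meson orbit.base orbit_trans)
  qed
  show "transitive_on f X"
    unfolding transitive_on_def
  proof (intro ballI)
    fix x x' assume x: "x \<in> X" "x' \<in> X"
    show "x' \<in> orbit f x"
    proof (cases "x' \<in> e ` Y")
      case True
      then show ?thesis
        using to_image x by blast
    next
      case False
      \<comment> \<open>Two consecutive points cannot both lie outside the image, so the predecessor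
        of \<open>x'\<close> is in the image and is already reached.\<close>
      obtain z where z: "z \<in> X" "x' = f z"
        using f x by blast
      with False have "z \<in> e ` Y"
        using skip by blast
      then show ?thesis
        using to_image[OF x(1)] z by (auto intro: orbit.step)
    qed
  qed
qed

section \<open>Enlarging a part\<close>

definition exchange_transitive :: "nat list \<Rightarrow> bool" where
  "exchange_transitive l \<longleftrightarrow> transitive_on (exchange l) {1..weight l}"

text \<open>Transitivity is vacuous for the empty list, which has no orbit at all; hence the
  condition \<open>l \<noteq> []\<close>.\<close>

lemma circular_iff:
  "circular l \<longleftrightarrow> (\<forall>a\<in>set l. 0 < a) \<and> l \<noteq> [] \<and> exchange_transitive l"
proof -
  let ?X = "{1..weight l}"
  have "orbit (interval_exchange l) x = orbit (exchange l) x" if "x \<in> ?X" for x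
    using that exchange_image[of l]
    by (intro orbit_cong_invariant[where X = ?X])
      (auto simp: interval_exchange_eq_exchange image_subset_iff)
  then have "orbit (interval_exchange l) ` ?X = orbit (exchange l) ` ?X"
    by (rule image_cong[OF refl])
  then have "card (orbit (interval_exchange l) ` ?X) = 1 \<longleftrightarrow> ?X \<noteq> {} \<and> exchange_transitive l"
    using transitive_on_iff_card_orbits[OF exchange_image] by (simp add: exchange_transitive_def)
  moreover have "?X \<noteq> {} \<longleftrightarrow> l \<noteq> []" if "\<forall>a\<in>set l. 0 < a"
    using that by (cases l) auto
  ultimately show ?thesis
    by (auto simp: circular_def composition_of_def)
qed

section \<open>Comparing exchanges with and without a middle part\<close>

lemma exchange_insert:
  assumes "0 < x"
  shows "exchange (A @ c # B) x =
    (if x \<le> weight A then exchange (A @ B) x + int c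
     else if x \<le> weight A + int c then x + weight B - weight A
     else exchange (A @ B) (x - int c))"
proof (cases "x \<le> weight A")
  case True
  then show ?thesis
    using assms by (simp add: exchange_append_left)
next
  case False
  have "exchange (A @ c # B) x = exchange (c # B) (x - weight A)"
    using exchange_append_right[of "x - weight A" A "c # B"] False by simp
  moreover have "exchange (A @ B) (x - int c) = exchange B (x - int c - weight A)"
    if "\<not> x \<le> weight A + int c"
    using exchange_append_right[of "x - int c - weight A" A B] that by simp
  ultimately show ?thesis
    using False by (simp add: algebra_simps)
qed

lemma exchange_in_range:
  assumes "0 < x" "x \<le> weight l"
  shows "0 < exchange l x" "exchange l x \<le> weight l"
proof -
  have "exchange l x \<in> exchange l ` {1..weight l}"
    using assms by (intro imageI) simp
  then show "0 < exchange l x" "exchange l x \<le> weight l"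
    unfolding exchange_image by simp_all
qed

text \<open>Images of points of \<open>A\<close> occupy the top places and those of \<open>B\<close>
  the bottom ones. Comparing the threshold \<open>weight B\<close> with the position of the enlarged
  block tells which steps can land in the added points.\<close>

lemma exchange_append_bounds:
  assumes "0 < x"
  shows "x \<le> weight A \<Longrightarrow> weight B < exchange (A @ B) x \<and> exchange (A @ B) x \<le> weight A + weight B"
    and "weight A < x \<Longrightarrow> x \<le> weight A + weight B \<Longrightarrow>
      0 < exchange (A @ B) x \<and> exchange (A @ B) x \<le> weight B"
proof -
  assume "x \<le> weight A"
  then show "weight B < exchange (A @ B) x \<and> exchange (A @ B) x \<le> weight A + weight B"
    using exchange_append_left[of x A B] exchange_in_range[of x A] assms by simp
next
  assume "weight A < x" "x \<le> weight A + weight B"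
  then show "0 < exchange (A @ B) x \<and> exchange (A @ B) x \<le> weight B"
    using exchange_append_right[of "x - weight A" A B] exchange_in_range[of "x - weight A" B] by simp
qed

lemma exchange_transitive_insert_0: "exchange_transitive (A @ 0 # B) = exchange_transitive (A @ B)"
proof -
  have "orbit (exchange (A @ 0 # B)) x = orbit (exchange (A @ B)) x"
    if "x \<in> {1..weight (A @ 0 # B)}" for x
    using that exchange_image[of "A @ 0 # B"]
    by (intro orbit_cong_invariant[where X = "{1..weight (A @ 0 # B)}"])
      (auto simp: exchange_insert)
  then show ?thesis
    by (simp add: exchange_transitive_def transitive_on_def)
qed

text \<open>\<open>?e\<close> opens a gap of \<open>p\<close> points at the right end of the block.
  The block moves by exactly \<open>p\<close>, so \<open>?f\<close> sends a gap point
  \<open>z\<close> to \<open>z + p\<close>, which is \<open>?e z\<close>: one more step repairs a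
  landing in the gap. Such landings come only from the block itself and from points to its
  right.\<close>

lemma exchange_transitive_enlarge_pos:
  assumes p: "weight B - weight A = int p"
  shows "exchange_transitive (A @ (c + p) # B) = exchange_transitive (A @ c # B)"
  unfolding exchange_transitive_def
proof (rule transitive_on_first_return)
  let ?a = "weight A"
  let ?X = "{1..weight (A @ (c + p) # B)}" and ?Y = "{1..weight (A @ c # B)}"
  let ?f = "exchange (A @ (c + p) # B)" and ?g = "exchange (A @ c # B)"
  let ?e = "\<lambda>y. if y \<le> ?a + int c then y else y + int p"
  have img: "x \<in> ?e ` ?Y \<longleftrightarrow> x \<in> ?X \<and> (x \<le> ?a + int c \<or> ?a + int c + int p < x)" for x
    by (auto simp: image_iff intro: bexI[of _ x] bexI[of _ "x - int p"])
  show "?f ` ?X = ?X" "?g ` ?Y \<subseteq> ?Y"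
    using exchange_image by blast+
  show "inj_on ?e ?Y"
    by (auto simp: inj_on_def)
  show "?e ` ?Y \<subseteq> ?X"
    by auto
  show "?f x \<in> ?e ` ?Y" if "x \<in> ?X" "x \<notin> ?e ` ?Y" for x
    using that p unfolding img by (auto simp: exchange_insert)
  show "?f (?e y) = ?e (?g y) \<or> ?f (?e y) \<notin> ?e ` ?Y \<and> ?f (?f (?e y)) = ?e (?g y)"
    if y: "y \<in> ?Y" for y
  proof -
    consider "y \<le> ?a" | "?a < y" "y \<le> ?a + int c" | "?a + int c < y"
      by linarith
    then show ?thesis
    proof cases
      case 1
      then show ?thesis
        using y p exchange_append_bounds(1)[of y A B] unfolding img
        by (auto simp: exchange_insert)
    next
      case 2
      then show ?thesis
        using y p unfolding img by (auto simp: exchange_insert)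
    next
      case 3
      then show ?thesis
        using y p exchange_append_bounds(2)[of "y - int c" A B] unfolding img
        by (auto simp: exchange_insert)
    qed
  qed
qed

text \<open>Mirror image: the gap is at the left end and its points move by \<open>-p\<close>, back
  to the places that \<open>?e\<close> leaves fixed. Landings in the gap now come from the block and
  from points to its left.\<close>

lemma exchange_transitive_enlarge_neg:
  assumes p: "weight A - weight B = int p"
  shows "exchange_transitive (A @ (c + p) # B) = exchange_transitive (A @ c # B)"
  unfolding exchange_transitive_def
proof (rule transitive_on_first_return)
  let ?a = "weight A"
  let ?X = "{1..weight (A @ (c + p) # B)}" and ?Y = "{1..weight (A @ c # B)}"
  let ?f = "exchange (A @ (c + p) # B)" and ?g = "exchange (A @ c # B)"
  let ?e = "\<lambda>y. if y \<le> ?a then y else y + int p"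
  have img: "x \<in> ?e ` ?Y \<longleftrightarrow> x \<in> ?X \<and> (x \<le> ?a \<or> ?a + int p < x)" for x
    by (auto simp: image_iff intro: bexI[of _ x] bexI[of _ "x - int p"])
  show "?f ` ?X = ?X" "?g ` ?Y \<subseteq> ?Y"
    using exchange_image by blast+
  show "inj_on ?e ?Y"
    by (auto simp: inj_on_def)
  show "?e ` ?Y \<subseteq> ?X"
    by auto
  show "?f x \<in> ?e ` ?Y" if "x \<in> ?X" "x \<notin> ?e ` ?Y" for x
    using that p unfolding img by (auto simp: exchange_insert)
  show "?f (?e y) = ?e (?g y) \<or> ?f (?e y) \<notin> ?e ` ?Y \<and> ?f (?f (?e y)) = ?e (?g y)"
    if y: "y \<in> ?Y" for y
  proof -
    consider "y \<le> ?a" | "?a < y" "y \<le> ?a + int c" | "?a + int c < y"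
      by linarith
    then show ?thesis
    proof cases
      case 1
      then show ?thesis
        using y p exchange_append_bounds(1)[of y A B] unfolding img
        by (auto simp: exchange_insert)
    next
      case 2
      then show ?thesis
        using y p unfolding img by (auto simp: exchange_insert)
    next
      case 3
      then show ?thesis
        using y p exchange_append_bounds(2)[of "y - int c" A B] unfolding img
        by (auto simp: exchange_insert)
    qed
  qed
qed

lemma exchange_transitive_enlarge:
  "exchange_transitive (A @ (c + nat \<bar>weight B - weight A\<bar>) # B) = exchange_transitive (A @ c # B)"
proof (cases "weight A \<le> weight B")
  case True
  then show ?thesis
    by (intro exchange_transitive_enlarge_pos) simp
next
  case False
  then show ?thesis
    by (intro exchange_transitive_enlarge_neg) simp
qed

section \<open>Parents\<close>

text \<open>A block of shift \<open>0\<close> consists of fixed points, and a transitive exchange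
  with a fixed point acts on a single point.\<close>

lemma circular_zero_shift:
  assumes circ: "circular (A @ k # B)" and "weight A = weight B"
  shows "A @ k # B = [1]"
proof -
  let ?l = "A @ k # B"
  have pos: "\<forall>a\<in>set ?l. 0 < a" and tr: "exchange_transitive ?l"
    using circ by (simp_all add: circular_iff)
  define x where "x = weight A + 1"
  have fixed: "exchange ?l x = x"
    using assms pos by (simp add: exchange_insert x_def)
  have "z = x" if "z \<in> orbit (exchange ?l) x" for z
    using that by induction (use fixed in auto)
  moreover have "x \<in> {1..weight ?l}"
    using pos by (auto simp: x_def)
  moreover have "weight ?l \<in> {1..weight ?l}" "1 \<in> {1..weight ?l}"
    using pos by auto
  ultimately have "weight ?l = x" "1 = x"
    using tr unfolding exchange_transitive_def transitive_on_def by metis+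
  then have w: "weight A = 0" "weight B = 0" "k = 1"
    using assms(2) unfolding x_def sum_list_append sum_list.Cons of_nat_add by linarith+
  moreover have "A = []" "B = []"
    using w pos by (cases A; cases B; auto)+
  ultimately show ?thesis
    by simp
qed

text \<open>The two equal blocks have shifts \<open>k\<close> and \<open>-k\<close>, so
  \<open>x\<close> and \<open>x + int k\<close> form a whole orbit and the total is at most
  2.\<close>

lemma circular_equal_halves:
  assumes circ: "circular (A @ k # k # B)" and "weight A = weight B"
  shows "A @ k # k # B = [1, 1]"
proof -
  let ?l = "A @ k # k # B"
  have pos: "\<forall>a\<in>set ?l. 0 < a" and tr: "exchange_transitive ?l"
    using circ by (simp_all add: circular_iff)
  define x where "x = weight A + 1"
  have swap: "exchange ?l x = x + int k"
    using assms pos by (simp add: exchange_insert x_def)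
  have swap': "exchange ?l (x + int k) = x"
    using assms pos exchange_insert[of "x + int k" "A @ [k]" k B] by (simp add: x_def)
  have "z = x \<or> z = x + int k" if "z \<in> orbit (exchange ?l) x" for z
    using that by induction (use swap swap' in auto)
  moreover have "x \<in> {1..weight ?l}"
    using pos by (auto simp: x_def)
  ultimately have "{1..weight ?l} \<subseteq> {x, x + int k}"
    using tr unfolding exchange_transitive_def transitive_on_def by blast
  then have "card {1..weight ?l} \<le> card {x, x + int k}"
    by (intro card_mono) auto
  also have "\<dots> \<le> 2"
    by (simp add: card_insert_if)
  finally have "sum_list ?l \<le> 2"
    by simp
  moreover have "k > 0"
    using pos by simp
  ultimately have w: "weight A = 0" "weight B = 0" "k = 1"
    unfolding sum_list_append sum_list.Cons by linarith+
  moreover have "A = []" "B = []"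
    using w pos by (cases A; cases B; auto)+
  ultimately show ?thesis
    by simp
qed

text \<open>\<open>parent_edge A k B l c\<close>: the composition \<open>A @ k # B\<close> is the child of \<open>l\<close> of index \<open>c\<close>, and
  \<open>k\<close> is its enlarged or inserted part.\<close>

definition parent_edge :: "nat list \<Rightarrow> nat \<Rightarrow> nat list \<Rightarrow> nat list \<Rightarrow> child_index \<Rightarrow> bool" where
  "parent_edge A k B l c \<longleftrightarrow>
     (\<bar>weight B - weight A\<bar> < int k \<and> l = A @ (k - nat \<bar>weight B - weight A\<bar>) # B \<and>
        c = Type1 (Suc (length A))) \<or>
     (l = A @ B \<and> c = Type2 (length A) \<and>
        (weight B - weight A = int k \<and> (B \<noteq> [] \<longrightarrow> hd B < k) \<or>
         weight A - weight B = int k \<and> (A \<noteq> [] \<longrightarrow> last A < k)))"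

section \<open>The child relation seen from the child\<close>

lemma part_Suc_length: "part (A @ B) (Suc (length A)) = (if B = [] then 0 else int (hd B))"
  by (cases B) (auto simp: part_def)

lemma part_length: "part (A @ B) (length A) = (if A = [] then 0 else int (last A))"
  by (cases A rule: rev_cases) (auto simp: part_def nth_append)

lemma child_iff_parent_edge:
  assumes pos: "\<forall>a\<in>set l. 0 < a" "\<forall>a\<in>set m. 0 < a"
  shows "has_child l c \<and> child l c = m \<longleftrightarrow> (\<exists>A k B. m = A @ k # B \<and> parent_edge A k B l c)"
proof
  assume hc: "has_child l c \<and> child l c = m"
  show "\<exists>A k B. m = A @ k # B \<and> parent_edge A k B l c"
  proof (cases c)
    case (Type1 t)
    define A where "A = take (t - 1) l"
    define B where "B = drop t l"
    define k where "k = l ! (t - 1)"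
    have t: "1 \<le> t" "t \<le> length l"
      using hc Type1 by auto
    then have l: "l = A @ k # B" and len: "t = Suc (length A)"
      using id_take_nth_drop[of "t - 1" l] by (auto simp: A_def B_def k_def)
    have "k > 0"
      using pos l by auto
    moreover have "shift l t = weight B - weight A"
      using t by (simp add: shift_eq A_def B_def)
    then have "m = A @ (k + nat \<bar>weight B - weight A\<bar>) # B"
      using hc Type1 unfolding l len by simp
    ultimately show ?thesis
      using l len Type1 by (intro exI[of _ A] exI[of _ B] exI) (auto simp: parent_edge_def)
  next
    case (Type2 t)
    define A where "A = take t l"
    define B where "B = drop t l"
    have t: "t \<le> length l"
      using hc Type2 by auto
    then have l: "l = A @ B" and len: "t = length A"
      by (auto simp: A_def B_def)
    have "m = A @ nat \<bar>weight B - weight A\<bar> # B"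
      using hc Type2 unfolding l len by (simp add: delta_append)
    moreover have "parent_edge A (nat \<bar>weight B - weight A\<bar>) B l c"
      using hc unfolding parent_edge_def Type2 l len
      by (auto simp: delta_append part_Suc_length part_length split: if_splits)
    ultimately show ?thesis
      by blast
  qed
next
  assume "\<exists>A k B. m = A @ k # B \<and> parent_edge A k B l c"
  then obtain A k B where m: "m = A @ k # B" and pe: "parent_edge A k B l c"
    by blast
  show "has_child l c \<and> child l c = m"
  proof (cases c)
    case (Type1 t)
    then have *: "\<bar>weight B - weight A\<bar> < int k" "t = Suc (length A)"
      "l = A @ (k - nat \<bar>weight B - weight A\<bar>) # B"
      using pe by (auto simp: parent_edge_def)
    then have "shift l t = weight B - weight A"
      by (simp add: shift_eq)
    then show ?thesis
      using * m Type1 by (simp add: nth_append)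
  next
    case (Type2 t)
    then show ?thesis
      \<comment> \<open>At an end of the list the neighbouring part counts as \<open>0\<close>, so
        the condition of type 2 becomes \<open>0 < k\<close>, which positivity of \<open>m\<close>
        supplies.\<close>
      using pe m pos unfolding parent_edge_def
      by (auto simp: delta_append part_Suc_length part_length)
  qed
qed

text \<open>Both parts must reach the midpoint. Adding the two inequalities forces \<open>D\<close>
  to be empty and both to be equalities, so both edges are of type 2 and each part would have to be
  strictly longer than the other.\<close>

lemma parent_edge_split_unique:
  assumes "parent_edge A k B l c" "parent_edge (A @ k # D) k' B' l' c'"
    and "B = D @ k' # B'" "\<forall>a\<in>set (A @ k # B). 0 < a"
  shows False
proof -
  have le: "weight B - weight A \<le> int k" "weight (A @ k # D) - weight B' \<le> int k'"
    using assms(1,2) unfolding parent_edge_def by (elim disjE conjE; linarith)+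
  then have "weight D = 0"
    unfolding assms(3) sum_list_append sum_list.Cons of_nat_add by linarith
  then have "D = []"
    using assms(3,4) by (cases D) auto
  then have B: "B = k' # B'"
    using assms(3) by simp
  have pos: "0 < k" "0 < k'"
    using assms(4) B by auto
  have eq: "weight B - weight A = int k" "weight (A @ [k]) - weight B' = int k'"
    using le unfolding B \<open>D = []\<close> sum_list_append sum_list.Cons of_nat_add by simp_all
  \<comment> \<open>Shift \<open>k\<close> rules out type 1, and its sign selects the first
    alternative of type 2.\<close>
  have "hd B < k"
    using assms(1) eq(1) pos unfolding parent_edge_def
    by (elim disjE conjE) (linarith | simp add: B)+
  moreover have "last (A @ [k]) < k'"
    using assms(2) eq(2) pos unfolding parent_edge_def \<open>D = []\<close>
    by (elim disjE conjE) (linarith | simp)+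
  ultimately show False
    by (simp add: B)
qed

lemma parent_edge_unique:
  assumes pe: "parent_edge A k B l c" "parent_edge A' k' B' l' c'"
    and eq: "A @ k # B = A' @ k' # B'" and pos: "\<forall>a\<in>set (A @ k # B). 0 < a"
  shows "l = l' \<and> c = c'"
proof -
  consider D where "A' = A @ k # D" "B = D @ k' # B'"
    | D where "A = A' @ k' # D" "B' = D @ k # B"
    | "A = A'" "k = k'" "B = B'"
    using eq by (auto simp: append_eq_append_conv2 Cons_eq_append_conv append_eq_Cons_conv)
  then show ?thesis
  proof cases
    case 1
    then show ?thesis
      using parent_edge_split_unique[OF pe(1)] pe(2) pos by blast
  next
    case 2
    then show ?thesis
      using parent_edge_split_unique[OF pe(2)] pe(1) pos eq by metis
  next
    case 3
    then show ?thesis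
      using pe pos by (auto simp: parent_edge_def)
  qed
qed

lemma parent_edge_exchange_transitive:
  assumes "parent_edge A k B l c"
  shows "exchange_transitive (A @ k # B) = exchange_transitive l"
proof -
  let ?s = "nat \<bar>weight B - weight A\<bar>"
  consider "?s \<le> k" "l = A @ (k - ?s) # B" | "k = ?s" "l = A @ B"
    using assms by (auto simp: parent_edge_def)
  then show ?thesis
  proof cases
    case 1
    then show ?thesis
      using exchange_transitive_enlarge[of A "k - ?s" B] by simp
  next
    case 2
    then show ?thesis
      using exchange_transitive_enlarge[of A 0 B] by (simp add: exchange_transitive_insert_0)
  qed
qed

lemma circular_child:
  assumes "circular l" "has_child l c"
  shows "circular (child l c)"
proof -
  have pos: "\<forall>a\<in>set l. 0 < a"
    using assms by (simp add: circular_iff)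
  have pos': "\<forall>a\<in>set (child l c). 0 < a"
  proof (cases c)
    case (Type1 t)
    then have "l ! (t - 1) > 0"
      using pos assms(2) by auto
    then show ?thesis
      using Type1 pos set_update_subset_insert[of l "t - 1"] by fastforce
  next
    case (Type2 t)
    have "0 \<le> part l t" "0 \<le> part l (t + 1)"
      by (simp_all add: part_def)
    \<comment> \<open>The inserted part is positive because \<open>\<bar>delta l t\<bar>\<close>
      strictly exceeds a nonnegative part.\<close>
    then have "delta l t \<noteq> 0"
      using assms(2) Type2 by auto
    then show ?thesis
      using Type2 pos by (auto dest: in_set_takeD in_set_dropD)
  qed
  obtain A k B where edge: "child l c = A @ k # B" "parent_edge A k B l c"
    using child_iff_parent_edge[OF pos pos', of c] assms(2) by blast
  then show ?thesis
    using parent_edge_exchange_transitive[OF edge(2)] assms(1) pos' by (simp add: circular_iff)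
qed

text \<open>The case \<open>l = l'\<close> also separates siblings, so a label determines its last
  edge.\<close>

lemma child_inject:
  assumes "circular l" "has_child l c" "circular l'" "has_child l' c'"
    and "child l c = child l' c'"
  shows "l = l' \<and> c = c'"
proof -
  have pos: "\<forall>a\<in>set l. 0 < a" "\<forall>a\<in>set l'. 0 < a" "\<forall>a\<in>set (child l c). 0 < a"
    using assms circular_child[of l c] by (simp_all add: circular_iff)
  obtain A k B where 1: "child l c = A @ k # B" "parent_edge A k B l c"
    using child_iff_parent_edge[OF pos(1,3), of c] assms by blast
  obtain A' k' B' where 2: "child l c = A' @ k' # B'" "parent_edge A' k' B' l' c'"
    using child_iff_parent_edge[OF pos(2,3), of c'] assms(4) assms(5)[symmetric] by blast
  show ?thesis
  proof (rule parent_edge_unique[OF 1(2) 2(2)])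
    show "A @ k # B = A' @ k' # B'"
      using 1(1) 2(1) by simp
    show "\<forall>a\<in>set (A @ k # B). 0 < a"
      using pos(3) unfolding 1(1) .
  qed
qed

text \<open>Either part of \<open>[1, 1]\<close> has shift of absolute value 1, which excludes type
  1, and its neighbour is not smaller, which excludes type 2.\<close>

lemma child_neq_root:
  assumes "circular l" "has_child l c"
  shows "child l c \<noteq> [1, 1]"
proof
  assume root: "child l c = [1, 1]"
  have pos: "\<forall>a\<in>set l. 0 < a" "\<forall>a\<in>set [1, 1::nat]. 0 < a"
    using assms by (simp_all add: circular_iff)
  obtain A k B where "[1, 1] = A @ k # B" "parent_edge A k B l c"
    using child_iff_parent_edge[OF pos, of c] assms root by blast
  then show False
    by (auto simp: parent_edge_def Cons_eq_append_conv)
qed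

text \<open>The part to shrink or delete is found at the midpoint; the strict drop of the sum drives
  the later descent to the root.\<close>

lemma circular_ex_parent:
  assumes circ: "circular m" and "m \<noteq> [1]" "m \<noteq> [1, 1]"
  obtains l c where "circular l" "l \<noteq> [1]" "has_child l c" "child l c = m"
    "sum_list l < sum_list m"
proof -
  have pos: "\<forall>a\<in>set m. 0 < a" and "m \<noteq> []"
    using circ by (simp_all add: circular_iff)
  then have "weight m > 0"
    by (cases m) auto
  \<comment> \<open>The midpoint rounded up: if it separates two blocks, the left one is chosen, so
    only the right-hand bound below can be an equality.\<close>
  then have "0 < (weight m + 1) div 2" "(weight m + 1) div 2 \<le> weight m"
    by linarith+
  then obtain A k B where m: "m = A @ k # B"
    and mid: "weight A < (weight m + 1) div 2" "(weight m + 1) div 2 \<le> weight A + int k"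
    by (rule ex_block_decomposition)
  then have mid: "weight A < weight B + int k" "weight B - weight A \<le> int k"
    by auto
  \<comment> \<open>With shift \<open>0\<close> the parent would be \<open>m\<close> itself and the
    sum would not drop.\<close>
  have neq: "weight A \<noteq> weight B"
    using circular_zero_shift[of A k B] assms m by blast
  have "\<exists>A k B l c. m = A @ k # B \<and> parent_edge A k B l c \<and> (\<forall>a\<in>set l. 0 < a) \<and>
      l \<noteq> [] \<and> l \<noteq> [1] \<and> sum_list l < sum_list m"
  proof (cases "weight B - weight A = int k")
    case False
    let ?l = "A @ (k - nat \<bar>weight B - weight A\<bar>) # B"
    have "parent_edge A k B ?l (Type1 (Suc (length A)))"
      using False mid by (auto simp: parent_edge_def)
    moreover have "\<forall>a\<in>set ?l. 0 < a"
      using pos m False mid by auto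
    moreover have "?l \<noteq> [1]"
      using neq by (auto simp: append_eq_Cons_conv)
    moreover have "sum_list ?l < sum_list m"
      using m neq mid by auto
    ultimately show ?thesis
      using m by blast
  next
    case True
    moreover have "k > 0"
      using pos m by auto
    ultimately obtain q B' where B: "B = q # B'"
      by (cases B) auto
    \<comment> \<open>If \<open>q = k\<close>, then \<open>weight A = weight B'\<close> and the
      equal halves force \<open>[1, 1]\<close>. Otherwise the longer of \<open>k\<close> and
      \<open>q\<close> is the inserted part.\<close>
    have "q \<noteq> k"
      using circular_equal_halves[of A k B'] assms m B True by auto
    then consider "q < k" | "k < q"
      by linarith
    then show ?thesis
    proof cases
      case 1
      have "parent_edge A k B (A @ B) (Type2 (length A))"
        using 1 B True by (auto simp: parent_edge_def)
      moreover have "\<forall>a\<in>set (A @ B). 0 < a" "sum_list (A @ B) < sum_list m" "A @ B \<noteq> []"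
        using pos m \<open>k > 0\<close> B by auto
      moreover have "A @ B \<noteq> [1]"
        using 1 B True by (auto simp: append_eq_Cons_conv)
      ultimately show ?thesis
        using m by blast
    next
      case 2
      have "parent_edge (A @ [k]) q B' ((A @ [k]) @ B') (Type2 (length (A @ [k])))"
        using 2 B True unfolding parent_edge_def by auto
      moreover have "\<forall>a\<in>set ((A @ [k]) @ B'). 0 < a" "sum_list ((A @ [k]) @ B') < sum_list m"
        using pos m B 2 by auto
      moreover have "(A @ [k]) @ B' \<noteq> [1]"
        using 2 B True by (auto simp: append_eq_Cons_conv)
      moreover have "m = (A @ [k]) @ q # B'"
        using m B by simp
      ultimately show ?thesis
        by blast
    qed
  qed
  then obtain A k B l c where *: "m = A @ k # B" "parent_edge A k B l c" "\<forall>a\<in>set l. 0 < a"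
    "l \<noteq> []" "l \<noteq> [1]" "sum_list l < sum_list m"
    by blast
  have "circular l"
    using parent_edge_exchange_transitive[OF *(2)] * circ by (simp add: circular_iff)
  moreover have "has_child l c \<and> child l c = m"
    using child_iff_parent_edge[OF *(3) pos] * by blast
  ultimately show thesis
    using that * by blast
qed

section \<open>The tree\<close>

lemma label_snoc: "label (v @ [c]) = child (label v) c"
  by (simp add: label_def)

text \<open>\<open>[1, 1]\<close> arises from \<open>[1]\<close> by enlarging a part
  \<open>0\<close>. This is not an edge, since the strict condition of type 2 fails, but enlargement
  preserves transitivity regardless.\<close>

lemma circular_root: "circular [1, 1]"
proof -
  have "exchange_transitive ([] @ (0 + nat \<bar>weight [1] - weight []\<bar>) # [1]) =
      exchange_transitive ([] @ 0 # [1])"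
    by (rule exchange_transitive_enlarge)
  moreover have "exchange_transitive [1]"
    using orbit.base[of "exchange [1]" 1]
    by (auto simp: exchange_transitive_def transitive_on_def)
  ultimately show ?thesis
    using exchange_transitive_insert_0[of "[]" "[1]"] by (simp add: circular_iff)
qed

lemma circular_label: "v \<in> tree_vertices \<Longrightarrow> circular (label v)"
proof (induction rule: tree_vertices.induct)
  case root
  then show ?case
    using circular_root by (simp add: label_def)
next
  case (child v c)
  then show ?case
    by (simp add: label_snoc circular_child)
qed

lemma label_inject:
  "v \<in> tree_vertices \<Longrightarrow> w \<in> tree_vertices \<Longrightarrow> label v = label w \<Longrightarrow> v = w"
proof (induction arbitrary: w rule: tree_vertices.induct)
  case root
  from root(1) show ?case
  proof cases
    case (child u c)
    then have "child (label u) c = [1, 1]"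
      using root(2) unfolding child(1) label_snoc by (simp add: label_def)
    then show ?thesis
      using child_neq_root circular_label child by blast
  qed simp
next
  case (child v c)
  from child.prems(1) show ?case
  proof cases
    case root
    then have "child (label v) c = [1, 1]"
      using child.prems(2) unfolding root label_snoc by (simp add: label_def)
    then show ?thesis
      using child_neq_root circular_label child.hyps by blast
  next
    case (child u d)
    have "label v = label u \<and> c = d"
      using \<open>label (v @ [c]) = label w\<close> \<open>v \<in> tree_vertices\<close> \<open>has_child (label v) c\<close> child
      by (intro child_inject) (simp_all add: label_snoc circular_label)
    then show ?thesis
      using child.IH child by blast
  qed
qed

lemma circular_ex_vertex:
  "circular l \<Longrightarrow> l \<noteq> [1] \<Longrightarrow> \<exists>v\<in>tree_vertices. label v = l"
proof (induction l rule: measure_induct_rule[of sum_list])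
  case (less l)
  show ?case
  proof (cases "l = [1, 1]")
    case True
    then show ?thesis
      using tree_vertices.root by (force simp: label_def)
  next
    case False
    then obtain m c where m: "circular m" "m \<noteq> [1]" "has_child m c" "child m c = l"
      "sum_list m < sum_list l"
      using circular_ex_parent less.prems by metis
    then obtain v where "v \<in> tree_vertices" "label v = m"
      using less.IH by blast
    then have "v @ [c] \<in> tree_vertices" "label (v @ [c]) = l"
      using m tree_vertices.child by (auto simp: label_snoc)
    then show ?thesis
      by blast
  qed
qed

text \<open>\<open>[1]\<close> is circular but labels no vertex: sums never decrease along edges and
  the root has sum 2. Hence it is excepted.\<close>

theorem theorem11:
  shows "(\<forall>l. circular l \<and> l \<noteq> [1] \<longrightarrow> (\<exists>!v. v \<in> tree_vertices \<and> label v = l)) \<and>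
         (\<forall>v\<in>tree_vertices. circular (label v))"
  using circular_ex_vertex label_inject circular_label by metis

end
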